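(* Let $1\le m\le n$, $N\ge 1$, let $\Omega\subseteq\mathbb{R}^n$ be a connected open set, let $X=\{X_1,\dots,X_m\}$ be a frame of vector fields with $X_i\in C^1(\Omega)^n$, and suppose $\Omega$ is equipped with a Riemannian metric which makes $X$ orthonormal. Assume that $\Omega$ is a Carnot-Carathéodory space with respect to $X$. Let $u\in\Gamma^2_{rk}(\Omega)^N$ solve the subelliptic $\infty$-Laplace system on $\Omega$: $$X_iu_\alpha\,X_ju_\beta\,X_iX_ju_\beta+\|Xu\|^2\,[Xu]^\bot_{\alpha\beta}\,X_iX_iu_\beta=0,\qquad \alpha=1,\dots,N.$$ Then, for any nonempty open $D\Subset\Omega$, $$\sup_D\|Xu\|=\max_{\partial D}\|Xu\|,\qquad \inf_D\|Xu\|=\min_{\partial D}\|Xu\|.$$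
   Context: Summation over repeated indices is used; Greek indices run over $1,\dots,N$, lowercase Latin over $1,\dots,m$. The horizontal subspace at $x$ is $H(x)=\mathrm{span}\{X_1(x),\dots,X_m(x)\}$. $X_iu(x)=\frac{d}{dt}\big|_{t=0}u(a(t))$ for a curve $a$ in $\Omega$ with $a(0)=x$, $a'(0)=X_i(x)$ (which may be taken to be $a(t)=x+tX_i(x)$). The horizontal gradient is $Xu=(X_iu_\alpha)\,e_\alpha\otimes X_i$, with $\|Xu\|^2=X_iu_\alpha X_iu_\alpha$; $\mathrm{rk}(Xu(x))$ is the rank of the $N\times m$ matrix $(X_iu_\alpha(x))$. $[Xu]^\bot(x)$ is the orthogonal projection of $\mathbb{R}^N$ onto the nullspace of the transpose $Xu(x)^\top:\mathbb{R}^N\to H(x)$, i.e. onto $\{\eta\in\mathbb{R}^N:\eta_\alpha X_iu_\alpha(x)=0\ \forall i\}$. $\Gamma^2(\Omega)^N$ is the set of $u:\Omega\to\mathbb{R}^N$ with $u,X_iu\in C^0(\Omega)^N$ and Euclidean derivatives $D(X_iu)\in C^0(\Omega)^{N\times n}$ for all $i$. $\Gamma^2_{rk}(\Omega)^N=\{u\in\Gamma^2(\Omega)^N:\mathrm{rk}(Xu)\equiv\min\{m,N\}\text{ on }\Omega\}$. An absolutely continuous curve $r:[0,T]\to\Omega$ is admissible if there are measurable $a_i:[0,T]\to\mathbb{R}$ with $r'(t)=a_i(t)X_i(r(t))$ and $a_i(t)a_i(t)\le1$ for a.e. $t\in[0,T]$. $\Omega$ is a Carnot-Carathéodory space (with respect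 to $X$) if any two points of $\Omega$ can be joined by an admissible curve lying in $\Omega$. $D\Subset\Omega$ means that $\overline D$ is compact and contained in $\Omega$. *)

theory Defs
  imports "HOL-Analysis.Analysis"
begin

text \<open>
  The dimensions \<open>n\<close>, \<open>m\<close>, \<open>N\<close> are the cardinalities of the finite index types \<open>'n\<close>, \<open>'m\<close>, \<open>'k\<close>.
  All maps are total functions on \<open>real^'n\<close>; only their values on the open set \<open>\<Omega>\<close> matter.
\<close>

definition C1_on :: "'a::euclidean_space set \<Rightarrow> ('a \<Rightarrow> 'b::real_normed_vector) \<Rightarrow> bool" where
  "C1_on \<Omega> f \<longleftrightarrow>
     (\<exists>f' :: 'a \<Rightarrow> 'a \<Rightarrow>\<^sub>L 'b.
        (\<forall>x\<in>\<Omega>. (f has_derivative blinfun_apply (f' x)) (at x)) \<and> continuous_on \<Omega> f')"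

definition frame_on :: "(real^'n) set \<Rightarrow> ('m::finite \<Rightarrow> real^'n \<Rightarrow> real^'n) \<Rightarrow> bool" where
  "frame_on \<Omega> X \<longleftrightarrow>
     (\<forall>x\<in>\<Omega>. inj (\<lambda>i. X i x) \<and> independent (range (\<lambda>i. X i x)))"

text \<open>Only continuity of the metric is required.\<close>

definition riemannian_metric_on ::
  "(real^'n) set \<Rightarrow> (real^'n \<Rightarrow> real^'n \<Rightarrow> real^'n \<Rightarrow> real) \<Rightarrow> bool" where
  "riemannian_metric_on \<Omega> g \<longleftrightarrow>
     (\<forall>x\<in>\<Omega>. bilinear (g x) \<and> (\<forall>v w. g x v w = g x w v) \<and> (\<forall>v. v \<noteq> 0 \<longrightarrow> 0 < g x v v)) \<and>
     (\<forall>v w. continuous_on \<Omega> (\<lambda>x. g x v w))"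

definition orthonormal_frame_on ::
  "(real^'n) set \<Rightarrow> (real^'n \<Rightarrow> real^'n \<Rightarrow> real^'n \<Rightarrow> real)
     \<Rightarrow> ('m::finite \<Rightarrow> real^'n \<Rightarrow> real^'n) \<Rightarrow> bool" where
  "orthonormal_frame_on \<Omega> g X \<longleftrightarrow>
     (\<forall>x\<in>\<Omega>. \<forall>i j. g x (X i x) (X j x) = (if i = j then 1 else 0))"

text \<open>
  The derivative of \<open>f\<close> at \<open>x\<close> along \<open>V\<close>, taken along the curve \<open>t \<mapsto> x + t V(x)\<close>. Since
  \<open>vector_derivative\<close> is total, existence is recorded separately. The map \<open>f\<close> itself need not be
  differentiable, so this is not phrased through a Euclidean derivative of \<open>f\<close>.
\<close>

definition has_lie_deriv_at ::
  "(real^'n \<Rightarrow> real^'n) \<Rightarrow> (real^'n \<Rightarrow> 'b::real_normed_vector) \<Rightarrow> real^'n \<Rightarrow> bool" where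
  "has_lie_deriv_at V f x \<longleftrightarrow> (\<lambda>t::real. f (x + t *\<^sub>R V x)) differentiable (at 0)"

definition lie_deriv ::
  "(real^'n \<Rightarrow> real^'n) \<Rightarrow> (real^'n \<Rightarrow> 'b::real_normed_vector) \<Rightarrow> real^'n \<Rightarrow> 'b" where
  "lie_deriv V f x = vector_derivative (\<lambda>t::real. f (x + t *\<^sub>R V x)) (at 0)"

text \<open>
  The \<open>N \<times> m\<close> matrix of the horizontal gradient in the orthonormal frame. The library norm on
  \<open>real^'m^'k\<close> is the Frobenius norm, so \<open>norm (hgrad X u x)\<close> is \<open>\<parallel>Xu(x)\<parallel>\<close>.
\<close>

definition hgrad ::
  "('m::finite \<Rightarrow> real^'n \<Rightarrow> real^'n) \<Rightarrow> (real^'n \<Rightarrow> real^'k) \<Rightarrow> real^'n \<Rightarrow> real^'m^'k" where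
  "hgrad X u x = (\<chi> \<alpha> i. lie_deriv (X i) u x $ \<alpha>)"

lemma norm_hgrad_squared:
  "(norm (hgrad X u x))\<^sup>2 =
     (\<Sum>i\<in>UNIV. \<Sum>\<alpha>\<in>UNIV. lie_deriv (X i) u x $ \<alpha> * lie_deriv (X i) u x $ \<alpha>)"
  unfolding hgrad_def
  by (subst sum.swap) (simp add: power2_norm_eq_inner inner_vec_def)

definition Gamma2 ::
  "(real^'n) set \<Rightarrow> ('m::finite \<Rightarrow> real^'n \<Rightarrow> real^'n) \<Rightarrow> (real^'n \<Rightarrow> real^'k) set" where
  "Gamma2 \<Omega> X = {u. continuous_on \<Omega> u \<and>
     (\<forall>i. (\<forall>x\<in>\<Omega>. has_lie_deriv_at (X i) u x) \<and>
          continuous_on \<Omega> (lie_deriv (X i) u) \<and>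
          C1_on \<Omega> (lie_deriv (X i) u))}"

definition Gamma2_rk ::
  "(real^'n) set \<Rightarrow> ('m::finite \<Rightarrow> real^'n \<Rightarrow> real^'n) \<Rightarrow> (real^'n \<Rightarrow> real^'k) set" where
  "Gamma2_rk \<Omega> X =
     {u \<in> Gamma2 \<Omega> X. \<forall>x\<in>\<Omega>. rank (hgrad X u x) = min CARD('m) CARD('k)}"

text \<open>Meant for subspaces \<open>S\<close> only, where the projection exists and is unique.\<close>

definition orth_proj :: "'a::euclidean_space set \<Rightarrow> 'a \<Rightarrow> 'a" where
  "orth_proj S x = (THE p. p \<in> S \<and> (\<forall>s\<in>S. orthogonal (x - p) s))"

definition normal_proj ::
  "('m::finite \<Rightarrow> real^'n \<Rightarrow> real^'n) \<Rightarrow> (real^'n \<Rightarrow> real^'k) \<Rightarrow> real^'n \<Rightarrow> real^'k^'k" where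
  "normal_proj X u x = matrix (orth_proj {\<eta>. transpose (hgrad X u x) *v \<eta> = 0})"

definition infinity_laplace_system_on ::
  "(real^'n) set \<Rightarrow> ('m::finite \<Rightarrow> real^'n \<Rightarrow> real^'n) \<Rightarrow> (real^'n \<Rightarrow> real^'k) \<Rightarrow> bool" where
  "infinity_laplace_system_on \<Omega> X u \<longleftrightarrow>
     (\<forall>x\<in>\<Omega>. \<forall>\<alpha>.
        (\<Sum>i\<in>UNIV. \<Sum>j\<in>UNIV. \<Sum>\<beta>\<in>UNIV.
            lie_deriv (X i) u x $ \<alpha> * lie_deriv (X j) u x $ \<beta>
              * lie_deriv (X i) (lie_deriv (X j) u) x $ \<beta>)
        + (norm (hgrad X u x))\<^sup>2
            * (\<Sum>i\<in>UNIV. \<Sum>\<beta>\<in>UNIV.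
                 normal_proj X u x $ \<alpha> $ \<beta> * lie_deriv (X i) (lie_deriv (X i) u) x $ \<beta>)
        = 0)"

text \<open>
  A division is a finite family of closed intervals with disjoint interiors;
  \<open>Inf K\<close> and \<open>Sup K\<close> are the endpoints of \<open>K\<close>.
\<close>

definition abs_continuous_on :: "real set \<Rightarrow> (real \<Rightarrow> 'a::real_normed_vector) \<Rightarrow> bool" where
  "abs_continuous_on I r \<longleftrightarrow>
     (\<forall>\<epsilon>>0. \<exists>\<delta>>0. \<forall>d S. d division_of S \<longrightarrow> S \<subseteq> I \<longrightarrow>
        (\<Sum>K\<in>d. Sup K - Inf K) < \<delta> \<longrightarrow> (\<Sum>K\<in>d. norm (r (Sup K) - r (Inf K))) < \<epsilon>)"

definition admissible_curve ::
  "(real^'n) set \<Rightarrow> ('m::finite \<Rightarrow> real^'n \<Rightarrow> real^'n) \<Rightarrow> real \<Rightarrow> (real \<Rightarrow> real^'n) \<Rightarrow> bool" where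
  "admissible_curve \<Omega> X T r \<longleftrightarrow>
     abs_continuous_on {0..T} r \<and> r ` {0..T} \<subseteq> \<Omega> \<and>
     (\<exists>a :: 'm \<Rightarrow> real \<Rightarrow> real.
        (\<forall>i. a i \<in> borel_measurable (lebesgue_on {0..T})) \<and>
        (AE t in lebesgue_on {0..T}.
           (r has_vector_derivative (\<Sum>i\<in>UNIV. a i t *\<^sub>R X i (r t))) (at t within {0..T}) \<and>
           (\<Sum>i\<in>UNIV. a i t * a i t) \<le> 1))"

definition carnot_caratheodory_space ::
  "(real^'n) set \<Rightarrow> ('m::finite \<Rightarrow> real^'n \<Rightarrow> real^'n) \<Rightarrow> bool" where
  "carnot_caratheodory_space \<Omega> X \<longleftrightarrow>
     (\<forall>x\<in>\<Omega>. \<forall>y\<in>\<Omega>. \<exists>T>0. \<exists>r. admissible_curve \<Omega> X T r \<and> r 0 = x \<and> r T = y)"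

end

theory Submission
  imports Defs
begin

text \<open>
  Write \<open>f = \<parallel>Xu\<parallel>\<^sup>2\<close> and let \<open>Xf\<close> be the vector of its derivatives along the frame. The first
  sum of the system is half of \<open>Xu Xf\<close>, which lies in the range of \<open>Xu\<close>; the second is a multiple
  of a vector in the nullspace of the transpose of \<open>Xu\<close>. The two are orthogonal, so a solution
  satisfies \<open>Xu Xf = 0\<close> (\<open>infinity_laplace_tangential_part\<close>). The rank hypothesis turns this
  into the claim in two different ways.

  If \<open>m \<le> N\<close>, then \<open>Xu\<close> is injective and \<open>Xf = 0\<close>. Hence \<open>f\<close> is constant along admissible
  curves (\<open>horizontally_constant_along_admissible_curve\<close>), and these join any two points of
  \<open>\<Omega>\<close>, so \<open>\<parallel>Xu\<parallel>\<close> is constant on \<open>\<Omega>\<close>. The analytic ingredient is that an absolutely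
  continuous function with derivative zero almost everywhere is constant.

  If \<open>m > N\<close>, then no row of \<open>Xu\<close> vanishes anywhere. Fix a component \<open>w = u\<^sub>\<alpha>\<close>; then
  \<open>Xw \<bullet> Xf = 0\<close> and \<open>Xw \<noteq> 0\<close>. For \<open>\<epsilon> > 0\<close> the function \<open>f + \<epsilon> w\<close> has no interior maximum:
  at such a point its derivative along each \<open>X\<^sub>i\<close> would vanish, and pairing \<open>Xf + \<epsilon> Xw = 0\<close> with
  \<open>Xw\<close> would give \<open>\<epsilon> \<parallel>Xw\<parallel>\<^sup>2 = 0\<close>. So its maximum over \<open>closure D\<close> is attained on the boundary,
  and \<open>\<epsilon> \<rightarrow> 0\<close> yields the same for \<open>f\<close> (\<open>frontier_max_of_transversal\<close>); the minimum
  follows by applying this to \<open>- f\<close>. Differentiating only along the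
  straight lines in the directions \<open>X\<^sub>i\<close> suits \<open>u\<close>, which is horizontally differentiable but may
  lack Euclidean derivatives.
\<close>

section \<open>Absolutely continuous functions with derivative zero almost everywhere\<close>

lemma tagged_partial_division_sum_snd:
  fixes d :: "real set \<Rightarrow> real"
  assumes q: "q tagged_partial_division_of {a..b}" and d0: "\<And>c. d {c} = 0"
  shows "(\<Sum>(x,K)\<in>q. d K) = sum d (snd ` q)"
proof -
  define d' where "d' K = (if K = {} then 0 else d K)" for K
  have "(\<Sum>(x,K)\<in>q. d' K) = sum d' (snd ` q)"
  proof (rule sum.over_tagged_division_lemma[OF tagged_partial_division_of_Union_self[OF q]])
    fix u v :: real
    assume "box u v = {}"
    then have "cbox u v = {} \<or> cbox u v = {u}"
      by (cases "u = v") (auto simp: box_real)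
    then show "d' (cbox u v) = 0"
      using d0 by (auto simp: d'_def)
  qed
  moreover have "(\<Sum>(x,K)\<in>q. d' K) = (\<Sum>(x,K)\<in>q. d K)" "sum d' (snd ` q) = sum d (snd ` q)"
    using tagged_partial_division_ofD(2)[OF q] by (auto simp: d'_def intro!: sum.cong) blast+
  ultimately show ?thesis
    by simp
qed

lemma abs_continuous_onE:
  assumes "abs_continuous_on I r" "e > 0"
  obtains \<delta> where "\<delta> > 0" "\<And>d S. d division_of S \<Longrightarrow> S \<subseteq> I \<Longrightarrow>
      (\<Sum>K\<in>d. Sup K - Inf K) < \<delta> \<Longrightarrow> (\<Sum>K\<in>d. norm (r (Sup K) - r (Inf K))) < e"
proof -
  have "\<exists>\<delta>>0. \<forall>d S. d division_of S \<longrightarrow> S \<subseteq> I \<longrightarrow>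
      (\<Sum>K\<in>d. Sup K - Inf K) < \<delta> \<longrightarrow> (\<Sum>K\<in>d. norm (r (Sup K) - r (Inf K))) < e"
    using assms(1)[unfolded abs_continuous_on_def, THEN spec, of e] assms(2) by (rule mp)
  then show ?thesis
    by (elim exE conjE) (rule that, assumption, blast)
qed

text \<open>
  Take a tagged division fine for a gauge with two regimes. Intervals tagged in the exceptional
  null set lie in an open set of small measure, so absolute continuity bounds their total
  contribution; the others contribute a small multiple of their length, because the derivative
  vanishes at the tag. The increments telescope to \<open>F b - F a\<close>.
\<close>
lemma abs_continuous_zero_derivative_constant:
  fixes F :: "real \<Rightarrow> 'a::real_normed_vector"
  assumes ac: "abs_continuous_on {a..b} F" and "a \<le> b" and E: "negligible E"
    and der: "\<And>t. t \<in> {a..b} - E \<Longrightarrow> (F has_vector_derivative 0) (at t within {a..b})"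
  shows "F b = F a"
proof -
  have "norm (F b - F a) \<le> 0 + e" if "e > 0" for e :: real
  proof -
    \<comment> \<open>The summand \<open>1\<close> keeps the denominator positive when \<open>a = b\<close>.\<close>
    define e' where "e' = e / 2 / (b - a + 1)"
    have "e' > 0" and e'_le: "e' * (b - a) \<le> e / 2"
      using that \<open>a \<le> b\<close> by (auto simp: e'_def field_simps)
    obtain \<delta> where "\<delta> > 0" and \<delta>: "\<And>d S. d division_of S \<Longrightarrow> S \<subseteq> {a..b} \<Longrightarrow>
        (\<Sum>K\<in>d. Sup K - Inf K) < \<delta> \<Longrightarrow> (\<Sum>K\<in>d. norm (F (Sup K) - F (Inf K))) < e / 2"
      by (rule abs_continuous_onE[OF ac half_gt_zero[OF \<open>e > 0\<close>]]) (rule that, assumption, blast)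
    obtain U where "open U" "E \<subseteq> U" and U: "U - E \<in> lmeasurable" "emeasure lebesgue (U - E) < ennreal \<delta>"
      using sets_lebesgue_outer_open[OF negligible_imp_sets[OF E] \<open>\<delta> > 0\<close>] by metis
    have "U \<in> lmeasurable"
      using U(1) E \<open>E \<subseteq> U\<close> fmeasurable_Diff_D negligible_imp_measurable by blast
    moreover have "measure lebesgue (U - E) = measure lebesgue U"
      using E by (simp add: calculation measure_Diff_null_set negligible_iff_null_sets fmeasurableD)
    ultimately have U_less: "measure lebesgue U < \<delta>" and Um: "U \<in> lmeasurable"
      using U \<open>\<delta> > 0\<close> by (metis emeasure_eq_measure2 ennreal_less_iff measure_nonneg)+
    \<comment> \<open>Tags outside \<open>{a..b}\<close> are unconstrained, but a gauge must be defined there too.\<close>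
    have "\<exists>G. open G \<and> t \<in> G \<and> (t \<in> E \<longrightarrow> G \<subseteq> U) \<and>
        (t \<in> {a..b} - E \<longrightarrow> (\<forall>y\<in>G \<inter> {a..b}. norm (F y - F t) \<le> e' * \<bar>y - t\<bar>))" for t
    proof (cases "t \<in> {a..b} - E")
      case True
      then obtain r where "r > 0"
        "\<And>y. y \<in> {a..b} \<Longrightarrow> norm (y - t) < r \<Longrightarrow> norm (F y - F t) \<le> e' * norm (y - t)"
        using der[OF True] \<open>e' > 0\<close> unfolding has_vector_derivative_def has_derivative_within_alt
        by auto
      then show ?thesis
        using True by (intro exI[of _ "ball t r"]) (auto simp: dist_norm norm_minus_commute)
    next
      case False
      then show ?thesis
        using \<open>open U\<close> \<open>E \<subseteq> U\<close> by (cases "t \<in> E") auto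
    qed
    then obtain \<gamma> where \<gamma>: "\<And>t. open (\<gamma> t)" "\<And>t. t \<in> \<gamma> t" "\<And>t. t \<in> E \<Longrightarrow> \<gamma> t \<subseteq> U"
      "\<And>t y. t \<in> {a..b} - E \<Longrightarrow> y \<in> \<gamma> t \<inter> {a..b} \<Longrightarrow> norm (F y - F t) \<le> e' * \<bar>y - t\<bar>"
      by metis
    have "gauge \<gamma>"
      using \<gamma> by (simp add: gauge_def)
    then obtain p where p: "p tagged_division_of {a..b}" and fine: "\<gamma> fine p"
      using fine_division_exists_real by blast
    have interval: "\<exists>c d. K = {c..d} \<and> c \<le> x \<and> x \<le> d \<and> Inf K = c \<and> Sup K = d
        \<and> K \<subseteq> {a..b} \<and> K \<subseteq> \<gamma> x"
      if xK: "(x, K) \<in> p" for x K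
    proof -
      obtain c d where "K = cbox c d"
        using tagged_division_ofD(4)[OF p xK] by blast
      then show ?thesis
        using tagged_division_ofD(2,3)[OF p that] fineD[OF fine that] by auto
    qed
    \<comment> \<open>The intervals tagged in the exceptional set\<close>
    define q where "q = {xK \<in> p. fst xK \<in> E}"
    have "finite p" "q \<subseteq> p"
      using p by (auto simp: q_def)
    have q: "q tagged_partial_division_of {a..b}"
      using p \<open>q \<subseteq> p\<close> tagged_partial_division_subset tagged_division_of_def by blast
    note div = partial_division_of_tagged_division[OF q]
    have "(\<Sum>(x,K)\<in>q. norm (F (Sup K) - F (Inf K))) = (\<Sum>K\<in>snd ` q. norm (F (Sup K) - F (Inf K)))"
      by (rule tagged_partial_division_sum_snd[OF q]) auto
    also have "\<dots> < e / 2"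
    proof (rule \<delta>[OF div])
      show "\<Union> (snd ` q) \<subseteq> {a..b}"
        using tagged_partial_division_ofD(3)[OF q] by fastforce
      have "(\<Sum>K\<in>snd ` q. Sup K - Inf K) = sum (measure lebesgue) (snd ` q)"
      proof (rule sum.cong)
        fix K assume "K \<in> snd ` q"
        then obtain x where "(x, K) \<in> p"
          using \<open>q \<subseteq> p\<close> by auto
        then obtain c d where "K = {c..d}" "c \<le> d"
          using interval by (meson order_trans)
        then show "Sup K - Inf K = measure lebesgue K"
          by simp
      qed simp
      also have "\<dots> = measure lebesgue (\<Union> (snd ` q))"
        by (rule content_division[OF div])
      also have "\<dots> \<le> measure lebesgue U"
      proof (rule measure_mono_fmeasurable[OF _ _ Um])
        show "\<Union> (snd ` q) \<subseteq> U"
          using interval \<gamma>(3) by (fastforce simp: q_def)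
        show "\<Union> (snd ` q) \<in> sets lebesgue"
          using lmeasurable_division[OF div] by blast
      qed
      finally show "(\<Sum>K\<in>snd ` q. Sup K - Inf K) < \<delta>"
        using U_less by simp
    qed
    finally have sum_q: "(\<Sum>(x,K)\<in>q. norm (F (Sup K) - F (Inf K))) < e / 2" .
    have "(\<Sum>(x,K)\<in>p - q. norm (F (Sup K) - F (Inf K))) \<le> (\<Sum>(x,K)\<in>p - q. e' * (Sup K - Inf K))"
    proof (rule sum_mono, clarify)
      fix x K assume xK: "(x, K) \<in> p" "(x, K) \<notin> q"
      then obtain c d where cd: "K = {c..d}" "c \<le> x" "x \<le> d" "Inf K = c" "Sup K = d"
          "K \<subseteq> {a..b}" "K \<subseteq> \<gamma> x"
        using interval[OF xK(1)] by blast
      then have "x \<in> {a..b} - E"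
        using xK by (auto simp: q_def)
      from \<gamma>(4)[OF this, of c] \<gamma>(4)[OF this, of d] cd
      have "norm (F c - F x) \<le> e' * (x - c)" "norm (F d - F x) \<le> e' * (d - x)"
        by (auto simp: subset_iff)
      then have "norm (F d - F c) \<le> e' * (x - c) + e' * (d - x)"
        using norm_triangle_ineq4[of "F d - F x" "F c - F x"] by simp
      then show "norm (F (Sup K) - F (Inf K)) \<le> e' * (Sup K - Inf K)"
        using cd by (simp add: algebra_simps)
    qed
    also have "\<dots> \<le> (\<Sum>(x,K)\<in>p. e' * (Sup K - Inf K))"
    proof (rule sum_mono2[OF \<open>finite p\<close>])
      fix b assume b: "b \<in> p - (p - q)"
      then obtain x K where "b = (x, K)"
        by (cases b)
      then show "0 \<le> (case b of (x, K) \<Rightarrow> e' * (Sup K - Inf K))"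
        using interval[of x K] b \<open>e' > 0\<close> by auto
    qed blast
    also have "\<dots> = e' * (\<Sum>(x,K)\<in>p. Sup K - Inf K)"
      by (simp add: sum_distrib_left case_prod_unfold)
    also have "\<dots> \<le> e / 2"
      using additive_tagged_division_1[OF \<open>a \<le> b\<close> p, of "\<lambda>x. x"] e'_le by simp
    finally have sum_pq: "(\<Sum>(x,K)\<in>p - q. norm (F (Sup K) - F (Inf K))) \<le> e / 2" .
    have "norm (F b - F a) = norm (\<Sum>(x,K)\<in>p. F (Sup K) - F (Inf K))"
      using additive_tagged_division_1[OF \<open>a \<le> b\<close> p, of F] by simp
    also have "\<dots> \<le> (\<Sum>(x,K)\<in>p. norm (F (Sup K) - F (Inf K)))"
      by (rule sum_norm_le) auto
    also have "\<dots> = (\<Sum>(x,K)\<in>p - q. norm (F (Sup K) - F (Inf K))) + (\<Sum>(x,K)\<in>q. norm (F (Sup K) - F (Inf K)))"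
      by (rule sum.subset_diff[OF \<open>q \<subseteq> p\<close> \<open>finite p\<close>])
    finally show ?thesis
      using sum_q sum_pq by simp
  qed
  then have "norm (F b - F a) \<le> 0"
    by (rule field_le_epsilon)
  then show ?thesis
    by simp
qed

lemma abs_continuous_on_imp_continuous_on:
  assumes "abs_continuous_on {a..b} r"
  shows "continuous_on {a..b} r"
  unfolding continuous_on_iff
proof (intro ballI allI impI)
  fix t and e :: real assume t: "t \<in> {a..b}" and "e > 0"
  obtain \<delta> where "\<delta> > 0" and \<delta>: "\<And>d S. d division_of S \<Longrightarrow> S \<subseteq> {a..b} \<Longrightarrow>
      (\<Sum>K\<in>d. Sup K - Inf K) < \<delta> \<Longrightarrow> (\<Sum>K\<in>d. norm (r (Sup K) - r (Inf K))) < e"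
    by (rule abs_continuous_onE[OF assms \<open>e > 0\<close>]) (rule that, assumption, blast)
  have ordered: "norm (r y - r x) < e" if "x \<in> {a..b}" "y \<in> {a..b}" "x \<le> y" "y - x < \<delta>" for x y
    using \<delta>[of "{cbox x y}" "{x..y}"] that division_of_self[of x y] by auto
  then have "dist (r s) (r t) < e" if "s \<in> {a..b}" "dist s t < \<delta>" for s
    using ordered[of s t] ordered[of t s] that t
    by (cases s t rule: linorder_le_cases) (auto simp: dist_norm norm_minus_commute)
  then show "\<exists>\<delta>>0. \<forall>s\<in>{a..b}. dist s t < \<delta> \<longrightarrow> dist (r s) (r t) < e"
    using \<open>\<delta> > 0\<close> by blast
qed

section \<open>Constancy along admissible curves\<close>

text \<open>
  The compact set need not be convex, so the mean value inequality gives only local Lipschitz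
  bounds on balls; compactness makes them uniform.
\<close>
lemma C1_on_lipschitz_on_compact:
  fixes f :: "'a::euclidean_space \<Rightarrow> 'b::real_normed_vector"
  assumes "C1_on \<Omega> f" "open \<Omega>" "compact K" "K \<subseteq> \<Omega>"
  obtains L where "L-lipschitz_on K f"
proof -
  obtain f' :: "'a \<Rightarrow> 'a \<Rightarrow>\<^sub>L 'b" where f': "\<And>x. x \<in> \<Omega> \<Longrightarrow> (f has_derivative blinfun_apply (f' x)) (at x)"
    and cont: "continuous_on \<Omega> f'"
    using assms(1) unfolding C1_on_def by blast
  have "local_lipschitz {0::real} \<Omega> (\<lambda>_. f)"
  proof (rule local_lipschitzI)
    fix t :: real and x assume "x \<in> \<Omega>"
    then obtain e where "e > 0" and e: "cball x e \<subseteq> \<Omega>"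
      using \<open>open \<Omega>\<close> open_contains_cball by blast
    have "compact (f' ` cball x e)"
      by (intro compact_continuous_image continuous_on_subset[OF cont e] compact_cball)
    then obtain B where "B > 0" and B: "\<And>y. y \<in> cball x e \<Longrightarrow> norm (f' y) \<le> B"
      by (auto dest!: compact_imp_bounded simp: bounded_pos)
    have "norm (f y - f z) \<le> B * norm (y - z)" if "y \<in> cball x e" "z \<in> cball x e" for y z
    proof (rule differentiable_bound[where S = "cball x e" and f' = "\<lambda>x. blinfun_apply (f' x)"])
      show "(f has_derivative blinfun_apply (f' w)) (at w within cball x e)" if "w \<in> cball x e" for w
        using f' e that has_derivative_at_withinI by blast
      show "onorm (blinfun_apply (f' w)) \<le> B" if "w \<in> cball x e" for w
        using B[OF that] by (simp add: norm_blinfun.rep_eq)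
    qed (use that in auto)
    then have "B-lipschitz_on (cball x e \<inter> \<Omega>) f"
      using \<open>B > 0\<close> by (intro lipschitz_onI) (auto simp: dist_norm)
    then show "\<exists>u>0. \<exists>L. \<forall>t\<in>cball t u \<inter> {0}. L-lipschitz_on (cball x u \<inter> \<Omega>) f"
      using \<open>e > 0\<close> by blast
  qed
  then have "local_lipschitz {0::real} K (\<lambda>_. f)"
    using \<open>K \<subseteq> \<Omega>\<close> local_lipschitz_subset by blast
  from local_lipschitz_compact_implies_lipschitz[OF this \<open>compact K\<close>] that show ?thesis
    by (metis compact_sing continuous_on_const singletonI)
qed

lemma abs_continuous_on_lipschitz_compose:
  assumes r: "abs_continuous_on {a..b} r" and f: "L-lipschitz_on (r ` {a..b}) f"
  shows "abs_continuous_on {a..b} (\<lambda>t. f (r t))"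
  unfolding abs_continuous_on_def
proof (intro allI impI)
  fix e :: real assume "e > 0"
  have "L \<ge> 0"
    using f by (simp add: lipschitz_on_def)
  then have "e / (L + 1) > 0"
    using \<open>e > 0\<close> by simp
  obtain \<delta> where "\<delta> > 0" and \<delta>: "\<And>d S. d division_of S \<Longrightarrow> S \<subseteq> {a..b} \<Longrightarrow>
      (\<Sum>K\<in>d. Sup K - Inf K) < \<delta> \<Longrightarrow> (\<Sum>K\<in>d. norm (r (Sup K) - r (Inf K))) < e / (L + 1)"
    by (rule abs_continuous_onE[OF r \<open>e / (L + 1) > 0\<close>]) (rule that, assumption, blast)
  have "(\<Sum>K\<in>d. norm (f (r (Sup K)) - f (r (Inf K)))) < e"
    if d: "d division_of S" "S \<subseteq> {a..b}" "(\<Sum>K\<in>d. Sup K - Inf K) < \<delta>" for d S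
  proof -
    \<comment> \<open>\<open>L + 1\<close> replaces \<open>L\<close> because a Lipschitz constant may be zero.\<close>
    have "(\<Sum>K\<in>d. norm (f (r (Sup K)) - f (r (Inf K)))) \<le> (\<Sum>K\<in>d. (L + 1) * norm (r (Sup K) - r (Inf K)))"
    proof (rule sum_mono)
      fix K assume "K \<in> d"
      obtain x y where "K = cbox x y"
        using division_ofD(4)[OF d(1) \<open>K \<in> d\<close>] by blast
      moreover have "K \<subseteq> {a..b}" "K \<noteq> {}"
        using division_ofD(2,3)[OF d(1) \<open>K \<in> d\<close>] d(2) by auto
      ultimately have "Sup K \<in> {a..b}" "Inf K \<in> {a..b}"
        by auto
      then have "norm (f (r (Sup K)) - f (r (Inf K))) \<le> L * norm (r (Sup K) - r (Inf K))"
        using lipschitz_onD[OF f, of "r (Sup K)" "r (Inf K)"] by (auto simp: dist_norm)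
      then show "norm (f (r (Sup K)) - f (r (Inf K))) \<le> (L + 1) * norm (r (Sup K) - r (Inf K))"
        by (simp add: distrib_right add_increasing2)
    qed
    also have "\<dots> < e"
      using \<delta>[OF d] \<open>L \<ge> 0\<close> by (simp add: pos_less_divide_eq mult.commute flip: sum_distrib_left)
    finally show ?thesis .
  qed
  then show "\<exists>\<delta>>0. \<forall>d S. d division_of S \<longrightarrow> S \<subseteq> {a..b} \<longrightarrow> (\<Sum>K\<in>d. Sup K - Inf K) < \<delta> \<longrightarrow>
      (\<Sum>K\<in>d. norm (f (r (Sup K)) - f (r (Inf K)))) < e"
    using \<open>\<delta> > 0\<close> by blast
qed

text \<open>
  At almost every time the velocity is horizontal, so the chain rule gives derivative zero for
  \<open>f\<close> along the curve. Continuity of the derivative of \<open>f\<close> enters through the Lipschitz bound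
  on the trace of the curve, which keeps the composition absolutely continuous.
\<close>
lemma horizontally_constant_along_admissible_curve:
  fixes f :: "real^'n \<Rightarrow> 'b::real_normed_vector" and X :: "'m::finite \<Rightarrow> real^'n \<Rightarrow> real^'n"
  assumes "open \<Omega>" and C1: "C1_on \<Omega> f"
    and der: "\<And>x. x \<in> \<Omega> \<Longrightarrow> (f has_derivative f' x) (at x)"
    and horiz: "\<And>x i. x \<in> \<Omega> \<Longrightarrow> f' x (X i x) = 0"
    and r: "admissible_curve \<Omega> X T r" and "T \<ge> 0"
  shows "f (r T) = f (r 0)"
proof -
  have ac: "abs_continuous_on {0..T} r" and img: "r ` {0..T} \<subseteq> \<Omega>"
    using r by (auto simp: admissible_curve_def)
  obtain a :: "'m \<Rightarrow> real \<Rightarrow> real" where "AE t in lebesgue_on {0..T}.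
      (r has_vector_derivative (\<Sum>i\<in>UNIV. a i t *\<^sub>R X i (r t))) (at t within {0..T}) \<and>
      (\<Sum>i\<in>UNIV. a i t * a i t) \<le> 1"
    using r unfolding admissible_curve_def by (elim conjE exE)
  then have "AE t in lebesgue_on {0..T}.
      (r has_vector_derivative (\<Sum>i\<in>UNIV. a i t *\<^sub>R X i (r t))) (at t within {0..T})"
    by (rule eventually_mono) simp
  then have "AE t in lebesgue. t \<in> {0..T} \<longrightarrow>
      (r has_vector_derivative (\<Sum>i\<in>UNIV. a i t *\<^sub>R X i (r t))) (at t within {0..T})"
    by (simp add: AE_restrict_space_iff)
  then obtain E where E: "negligible E" and r':
      "\<And>t. t \<in> {0..T} - E \<Longrightarrow> (r has_vector_derivative (\<Sum>i\<in>UNIV. a i t *\<^sub>R X i (r t))) (at t within {0..T})"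
    by (rule AE_E3) (auto simp: negligible_iff_null_sets)
  have "compact (r ` {0..T})"
    by (intro compact_continuous_image abs_continuous_on_imp_continuous_on[OF ac]) simp
  then obtain L where "L-lipschitz_on (r ` {0..T}) f"
    using C1_on_lipschitz_on_compact[OF C1 \<open>open \<Omega>\<close>] img by metis
  note ac' = abs_continuous_on_lipschitz_compose[OF ac this]
  have "((\<lambda>t. f (r t)) has_vector_derivative 0) (at t within {0..T})" if t: "t \<in> {0..T} - E" for t
  proof -
    have "r t \<in> \<Omega>"
      using img t by auto
    interpret f': bounded_linear "f' (r t)"
      using der[OF \<open>r t \<in> \<Omega>\<close>] by (rule has_derivative_bounded_linear)
    have "((f \<circ> r) has_vector_derivative f' (r t) (\<Sum>i\<in>UNIV. a i t *\<^sub>R X i (r t))) (at t within {0..T})"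
      using vector_derivative_diff_chain_within[OF r'[OF t] has_derivative_at_withinI[OF der[OF \<open>r t \<in> \<Omega>\<close>]]] .
    then show ?thesis
      by (simp add: f'.sum f'.scaleR horiz[OF \<open>r t \<in> \<Omega>\<close>] o_def)
  qed
  then show ?thesis
    using abs_continuous_zero_derivative_constant[OF ac' \<open>T \<ge> 0\<close> E] by blast
qed

lemma C1_on_norm_squared_sum:
  fixes v :: "'m::finite \<Rightarrow> 'a::euclidean_space \<Rightarrow> 'b::real_inner"
  assumes "\<And>j. C1_on \<Omega> (v j)"
  shows "C1_on \<Omega> (\<lambda>x. \<Sum>j\<in>UNIV. v j x \<bullet> v j x)"
proof -
  obtain v' :: "'m \<Rightarrow> 'a \<Rightarrow> 'a \<Rightarrow>\<^sub>L 'b"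
    where v': "\<And>j x. x \<in> \<Omega> \<Longrightarrow> (v j has_derivative blinfun_apply (v' j x)) (at x)"
      and cont': "\<And>j. continuous_on \<Omega> (v' j)"
    using assms unfolding C1_on_def by metis
  have cont: "continuous_on \<Omega> (v j)" for j
    using v' by (meson continuous_at_imp_continuous_on has_derivative_continuous)
  define w where "w x = (\<Sum>j\<in>UNIV. 2 *\<^sub>R (blinfun_inner_right (v j x) o\<^sub>L v' j x))" for x
  have "continuous_on \<Omega> w"
  proof (rule continuous_on_blinfun_componentwise)
    show "continuous_on \<Omega> (\<lambda>x. w x i)" for i
      unfolding w_def blinfun.sum_left blinfun.scaleR_left blinfun_apply_blinfun_compose blinfun_inner_right.rep_eq
      by (intro continuous_intros cont cont')
  qed
  moreover have "((\<lambda>x. \<Sum>j\<in>UNIV. v j x \<bullet> v j x) has_derivative w x) (at x)" if "x \<in> \<Omega>" for x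
  proof -
    have "((\<lambda>x. \<Sum>j\<in>UNIV. v j x \<bullet> v j x) has_derivative
        (\<lambda>h. \<Sum>j\<in>UNIV. v j x \<bullet> v' j x h + v' j x h \<bullet> v j x)) (at x)"
      by (intro has_derivative_sum has_derivative_inner v' that)
    moreover have "blinfun_apply (w x) = (\<lambda>h. \<Sum>j\<in>UNIV. v j x \<bullet> v' j x h + v' j x h \<bullet> v j x)"
      by (rule ext) (simp add: w_def blinfun.sum_left blinfun.scaleR_left inner_commute)
    ultimately show ?thesis
      by simp
  qed
  ultimately show ?thesis
    unfolding C1_on_def by blast
qed

section \<open>A maximum principle from a transversal function\<close>

lemma interior_max_derivative_zero:
  fixes \<phi> :: "'a::real_normed_vector \<Rightarrow> real"
  assumes "open D" "x \<in> D" "\<And>y. y \<in> D \<Longrightarrow> \<phi> y \<le> \<phi> x"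
    and "((\<lambda>t. \<phi> (x + t *\<^sub>R v)) has_real_derivative l) (at 0)"
  shows "l = 0"
proof -
  have "open ((\<lambda>t::real. x + t *\<^sub>R v) -` D)"
    by (intro continuous_open_vimage \<open>open D\<close> continuous_intros)
  then obtain d where "d > 0" and d: "ball 0 d \<subseteq> (\<lambda>t::real. x + t *\<^sub>R v) -` D"
    using \<open>x \<in> D\<close> by (auto simp: open_contains_ball dest!: bspec[of _ _ 0])
  show ?thesis
    using d assms(3) by (intro DERIV_local_max[OF assms(4) \<open>d > 0\<close>]) (auto simp: subset_iff)
qed

text \<open>
  The function \<open>w\<close> breaks ties: \<open>f\<close> alone may have interior maxima, but \<open>f + \<epsilon> w\<close> cannot,
  since at a critical point orthogonality of the two horizontal gradients forces that of \<open>w\<close> to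
  vanish. Only derivatives along lines are involved.
\<close>
lemma frontier_max_of_transversal:
  fixes f w :: "'a::euclidean_space \<Rightarrow> real" and X :: "'m::finite \<Rightarrow> 'a \<Rightarrow> 'a"
  assumes "open D" "D \<noteq> {}" and comp: "compact (closure D)"
    and cf: "continuous_on (closure D) f" and cw: "continuous_on (closure D) w"
    and df: "\<And>x i. x \<in> D \<Longrightarrow> ((\<lambda>t. f (x + t *\<^sub>R X i x)) has_real_derivative f' i x) (at 0)"
    and dw: "\<And>x i. x \<in> D \<Longrightarrow> ((\<lambda>t. w (x + t *\<^sub>R X i x)) has_real_derivative w' i x) (at 0)"
    and orth: "\<And>x. x \<in> D \<Longrightarrow> (\<Sum>i\<in>UNIV. w' i x * f' i x) = 0"
    and nz: "\<And>x. x \<in> D \<Longrightarrow> \<exists>i. w' i x \<noteq> 0"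
  obtains z where "z \<in> frontier D" "\<And>x. x \<in> closure D \<Longrightarrow> f x \<le> f z"
proof -
  have ne: "frontier D \<noteq> {}"
    using comp \<open>D \<noteq> {}\<close> by (metis closure_UNIV frontier_not_empty not_compact_UNIV)
  have sub: "frontier D \<subseteq> closure D"
    by (simp add: frontier_def)
  obtain z where z: "z \<in> frontier D" "\<And>y. y \<in> frontier D \<Longrightarrow> f y \<le> f z"
    using continuous_attains_sup[of "frontier D" f] ne sub continuous_on_subset[OF cf]
      compact_frontier_bounded compact_imp_bounded[OF comp] bounded_subset closure_subset by metis
  have "bounded (w ` closure D)"
    by (intro compact_imp_bounded compact_continuous_image cw comp)
  then obtain B where "B > 0" and B: "\<And>x. x \<in> closure D \<Longrightarrow> \<bar>w x\<bar> \<le> B"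
    by (auto simp: bounded_pos)
  have "f x \<le> f z + e" if x: "x \<in> closure D" and "e > 0" for x e
  proof -
    \<comment> \<open>Since \<open>w\<close> varies by at most \<open>2 * B\<close>, this perturbation costs at most \<open>e\<close>.\<close>
    define \<epsilon> where "\<epsilon> = e / (2 * B)"
    have "\<epsilon> > 0"
      using \<open>e > 0\<close> \<open>B > 0\<close> by (simp add: \<epsilon>_def)
    define \<phi> where "\<phi> x = f x + \<epsilon> * w x" for x
    have "continuous_on (closure D) \<phi>"
      unfolding \<phi>_def by (intro continuous_intros cf cw)
    then obtain y where y: "y \<in> closure D" "\<And>x. x \<in> closure D \<Longrightarrow> \<phi> x \<le> \<phi> y"
      using continuous_attains_sup[OF comp, of \<phi>] \<open>D \<noteq> {}\<close> by auto
    have "y \<notin> D"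
    proof
      assume "y \<in> D"
      have crit: "f' i y + \<epsilon> * w' i y = 0" for i
      proof (rule interior_max_derivative_zero[OF \<open>open D\<close> \<open>y \<in> D\<close>])
        show "\<phi> x \<le> \<phi> y" if "x \<in> D" for x
          using y(2) that closure_subset by blast
        show "((\<lambda>t. \<phi> (y + t *\<^sub>R X i y)) has_real_derivative f' i y + \<epsilon> * w' i y) (at 0)"
          unfolding \<phi>_def by (intro derivative_intros df dw \<open>y \<in> D\<close> DERIV_cmult)
      qed
      have "0 = (\<Sum>i\<in>UNIV. w' i y * (f' i y + \<epsilon> * w' i y))"
        by (simp add: crit)
      also have "\<dots> = \<epsilon> * (\<Sum>i\<in>UNIV. w' i y * w' i y)"
        using orth[OF \<open>y \<in> D\<close>]
        by (simp add: algebra_simps sum.distrib sum_distrib_left)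
      finally have "(\<Sum>i\<in>UNIV. w' i y * w' i y) = 0"
        using \<open>\<epsilon> > 0\<close> by simp
      then have "\<forall>i. w' i y = 0"
        by (simp add: sum_nonneg_eq_0_iff)
      then show False
        using nz[OF \<open>y \<in> D\<close>] by blast
    qed
    then have "y \<in> frontier D"
      using y(1) \<open>open D\<close> by (simp add: frontier_def interior_open)
    have "f x + \<epsilon> * w x \<le> f y + \<epsilon> * w y"
      using y(2)[OF x] by (simp add: \<phi>_def)
    moreover have "\<epsilon> * (w y - w x) \<le> \<epsilon> * (2 * B)"
      using B[OF x] B[OF y(1)] \<open>\<epsilon> > 0\<close> by (intro mult_left_mono) auto
    moreover have "\<epsilon> * (2 * B) = e"
      using \<open>B > 0\<close> by (simp add: \<epsilon>_def)
    ultimately show ?thesis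
      using z(2)[OF \<open>y \<in> frontier D\<close>] by (simp add: algebra_simps)
  qed
  then show ?thesis
    using that z(1) by (metis field_le_epsilon)
qed

text \<open>
  The boundary value is approached from inside, so it cannot exceed the supremum over \<open>D\<close>.
\<close>
lemma SUP_eq_frontier_max:
  fixes \<phi> :: "'a::metric_space \<Rightarrow> real"
  assumes "D \<noteq> {}" "continuous_on (closure D) \<phi>" "z \<in> frontier D"
    and max: "\<And>x. x \<in> closure D \<Longrightarrow> \<phi> x \<le> \<phi> z"
  shows "bdd_above (\<phi> ` D)" "(SUP x\<in>D. \<phi> x) = \<phi> z"
proof -
  show bdd: "bdd_above (\<phi> ` D)"
    using max closure_subset by (intro bdd_aboveI2[of _ _ "\<phi> z"]) blast
  have "z \<in> closure D"
    using \<open>z \<in> frontier D\<close> by (simp add: frontier_def)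
  have "\<phi> z \<le> (SUP x\<in>D. \<phi> x)"
    by (rule continuous_le_on_closure[OF assms(2) \<open>z \<in> closure D\<close>]) (rule cSUP_upper[OF _ bdd])
  moreover have "(SUP x\<in>D. \<phi> x) \<le> \<phi> z"
    using max closure_subset by (intro cSUP_least[OF \<open>D \<noteq> {}\<close>]) blast
  ultimately show "(SUP x\<in>D. \<phi> x) = \<phi> z"
    by simp
qed

lemma INF_eq_frontier_min:
  fixes \<phi> :: "'a::metric_space \<Rightarrow> real"
  assumes "D \<noteq> {}" "continuous_on (closure D) \<phi>" "z \<in> frontier D"
    and min: "\<And>x. x \<in> closure D \<Longrightarrow> \<phi> z \<le> \<phi> x"
  shows "bdd_below (\<phi> ` D)" "(INF x\<in>D. \<phi> x) = \<phi> z"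
proof -
  show bdd: "bdd_below (\<phi> ` D)"
    using min closure_subset by (intro bdd_belowI2[of _ "\<phi> z"]) blast
  have "z \<in> closure D"
    using \<open>z \<in> frontier D\<close> by (simp add: frontier_def)
  have "(INF x\<in>D. \<phi> x) \<le> \<phi> z"
    by (rule continuous_ge_on_closure[OF assms(2) \<open>z \<in> closure D\<close>]) (rule cINF_lower[OF bdd])
  moreover have "\<phi> z \<le> (INF x\<in>D. \<phi> x)"
    using min closure_subset by (intro cINF_greatest[OF \<open>D \<noteq> {}\<close>]) blast
  ultimately show "(INF x\<in>D. \<phi> x) = \<phi> z"
    by simp
qed

section \<open>The tangential part of the system\<close>

lemma orth_proj_in_subspace:
  fixes S :: "'a::euclidean_space set"
  assumes "subspace S"
  shows "orth_proj S x \<in> S"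
proof -
  obtain y z where yz: "y \<in> S" "\<And>w. w \<in> S \<Longrightarrow> orthogonal z w" "x = y + z"
    using orthogonal_subspace_decomp_exists[of S x] assms by (metis span_eq_iff)
  have "orth_proj S x = y"
    unfolding orth_proj_def
  proof (rule the_equality)
    show "y \<in> S \<and> (\<forall>s\<in>S. orthogonal (x - y) s)"
      using yz by simp
  next
    fix p assume p: "p \<in> S \<and> (\<forall>s\<in>S. orthogonal (x - p) s)"
    then have "p - y \<in> S"
      using yz(1) assms by (simp add: subspace_diff)
    then have "(x - y) \<bullet> (p - y) = 0" "(x - p) \<bullet> (p - y) = 0"
      using p yz by (simp_all add: orthogonal_def)
    then have "(p - y) \<bullet> (p - y) = 0"
      by (simp add: inner_diff_left)
    then show "p = y"
      by simp
  qed
  then show ?thesis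
    using yz by simp
qed

text \<open>
  The columns of the matrix are projections of the basis vectors, hence lie in the nullspace, and
  so do their linear combinations.
\<close>
lemma normal_proj_in_nullspace:
  fixes X :: "'m::finite \<Rightarrow> real^'n \<Rightarrow> real^'n" and u :: "real^'n \<Rightarrow> real^'k"
  shows "transpose (hgrad X u x) *v (normal_proj X u x *v w) = 0"
proof -
  define S where "S = {\<eta>. transpose (hgrad X u x) *v \<eta> = 0}"
  have "subspace S"
    by (auto simp: S_def subspace_def matrix_vector_right_distrib matrix_vector_mult_scaleR
        simp del: transpose_matrix_vector)
  have "normal_proj X u x *v w = (\<Sum>\<beta>\<in>UNIV. w $ \<beta> *\<^sub>R orth_proj S (axis \<beta> 1))"
    by (simp add: normal_proj_def S_def matrix_def matrix_vector_mult_def vec_eq_iff mult.commute)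
  also have "\<dots> \<in> S"
    by (intro subspace_sum subspace_scale \<open>subspace S\<close> orth_proj_in_subspace)
  finally show ?thesis
    by (simp add: S_def)
qed

text \<open>
  The range of a matrix is orthogonal to the nullspace of its transpose, so both summands vanish.
\<close>
lemma tangential_part_vanishes:
  fixes A :: "real^'m^'k"
  assumes sum0: "A *v g + c *\<^sub>R p = 0" and p: "transpose A *v p = 0"
  shows "A *v g = 0"
proof -
  have "A *v g = - (c *\<^sub>R p)"
    using sum0 by (simp add: eq_neg_iff_add_eq_0)
  then have "(A *v g) \<bullet> (A *v g) = - c * (p \<bullet> (A *v g))"
    by (metis inner_minus_left inner_scaleR_left mult_minus_left)
  also have "p \<bullet> (A *v g) = (transpose A *v p) \<bullet> g"
    by (simp add: dot_lmul_matrix)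
  finally show ?thesis
    by (simp only: p) simp
qed

lemma lie_deriv_has_vector_derivative:
  assumes "has_lie_deriv_at V f x"
  shows "((\<lambda>t. f (x + t *\<^sub>R V x)) has_vector_derivative lie_deriv V f x) (at 0)"
  using assms by (simp add: has_lie_deriv_at_def lie_deriv_def vector_derivative_works)

lemma has_derivative_along_line:
  assumes "(f has_derivative f') (at x)"
  shows "((\<lambda>t. f (x + t *\<^sub>R v)) has_vector_derivative f' v) (at 0)"
proof -
  have "((\<lambda>t. x + t *\<^sub>R v) has_vector_derivative v) (at 0)"
    by (auto intro!: derivative_eq_intros simp: has_vector_derivative_def)
  from vector_derivative_diff_chain_within[of _ _ 0 UNIV f f', OF this] assms show ?thesis
    by (simp add: o_def has_derivative_at_withinI)
qed

lemma lie_deriv_eq_derivative: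
  assumes "(f has_derivative f') (at x)"
  shows "lie_deriv V f x = f' (V x)"
  unfolding lie_deriv_def by (rule vector_derivative_at[OF has_derivative_along_line[OF assms]])

text \<open>
  Differentiating \<open>\<parallel>Xu\<parallel>\<^sup>2\<close> along \<open>X\<^sub>i\<close> gives twice \<open>X\<^sub>ju\<^sub>\<beta> X\<^sub>iX\<^sub>ju\<^sub>\<beta>\<close>, the factor that is contracted
  with \<open>X\<^sub>iu\<^sub>\<alpha>\<close> in the first sum of the system. So twice the system has the form
  \<open>Xu Xf + c p = 0\<close> with \<open>p\<close> normal.
\<close>
lemma infinity_laplace_tangential_part:
  fixes X :: "'m::finite \<Rightarrow> real^'n \<Rightarrow> real^'n" and u :: "real^'n \<Rightarrow> real^'k"
  assumes sys: "infinity_laplace_system_on \<Omega> X u" and "x \<in> \<Omega>"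
    and C1: "\<And>j. C1_on \<Omega> (lie_deriv (X j) u)"
    and f': "((\<lambda>x. (norm (hgrad X u x))\<^sup>2) has_derivative f') (at x)"
  shows "hgrad X u x *v (\<chi> i. f' (X i x)) = 0"
proof -
  have "\<exists>d. (lie_deriv (X j) u has_derivative d) (at x)" for j
    using C1[of j] \<open>x \<in> \<Omega>\<close> unfolding C1_on_def by blast
  then obtain v' where v': "\<And>j. (lie_deriv (X j) u has_derivative v' j) (at x)"
    by metis
  have "(\<lambda>x. (norm (hgrad X u x))\<^sup>2) = (\<lambda>x. \<Sum>j\<in>UNIV. lie_deriv (X j) u x \<bullet> lie_deriv (X j) u x)"
    by (simp add: norm_hgrad_squared inner_vec_def)
  moreover have "((\<lambda>x. \<Sum>j\<in>UNIV. lie_deriv (X j) u x \<bullet> lie_deriv (X j) u x) has_derivative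
        (\<lambda>h. \<Sum>j\<in>UNIV. lie_deriv (X j) u x \<bullet> v' j h + v' j h \<bullet> lie_deriv (X j) u x)) (at x)"
      by (intro has_derivative_sum has_derivative_inner v')
  ultimately have "f' = (\<lambda>h. \<Sum>j\<in>UNIV. lie_deriv (X j) u x \<bullet> v' j h + v' j h \<bullet> lie_deriv (X j) u x)"
    using has_derivative_unique[OF f'] by simp
  then have f'_eq: "f' (X i x) = 2 * (\<Sum>j\<in>UNIV. lie_deriv (X j) u x \<bullet> lie_deriv (X i) (lie_deriv (X j) u) x)" for i
    by (simp add: lie_deriv_eq_derivative[OF v'] inner_commute sum_distrib_left)
  define p where "p = normal_proj X u x *v (\<Sum>i\<in>UNIV. lie_deriv (X i) (lie_deriv (X i) u) x)"
  have "hgrad X u x *v (\<chi> i. f' (X i x)) + (2 * (norm (hgrad X u x))\<^sup>2) *\<^sub>R p = 0"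
  proof (rule vec_eq_iff[THEN iffD2], rule allI)
    fix \<alpha>
    have "(hgrad X u x *v (\<chi> i. f' (X i x))) $ \<alpha> =
        2 * (\<Sum>i\<in>UNIV. \<Sum>j\<in>UNIV. \<Sum>\<beta>\<in>UNIV. lie_deriv (X i) u x $ \<alpha> * lie_deriv (X j) u x $ \<beta>
              * lie_deriv (X i) (lie_deriv (X j) u) x $ \<beta>)"
      by (simp add: matrix_vector_mult_def hgrad_def f'_eq inner_vec_def sum_distrib_left mult.assoc mult.left_commute)
    moreover have "p $ \<alpha> = (\<Sum>i\<in>UNIV. \<Sum>\<beta>\<in>UNIV.
        normal_proj X u x $ \<alpha> $ \<beta> * lie_deriv (X i) (lie_deriv (X i) u) x $ \<beta>)"
      by (subst sum.swap) (simp add: p_def matrix_vector_mult_def sum_distrib_left)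
    moreover note sys[unfolded infinity_laplace_system_on_def, rule_format, OF \<open>x \<in> \<Omega>\<close>, of \<alpha>]
    ultimately show "(hgrad X u x *v (\<chi> i. f' (X i x)) + (2 * (norm (hgrad X u x))\<^sup>2) *\<^sub>R p) $ \<alpha> = 0 $ \<alpha>"
      by simp
  qed
  then show ?thesis
    by (rule tangential_part_vanishes) (unfold p_def, rule normal_proj_in_nullspace)
qed

section \<open>The maximum and minimum principle\<close>

theorem proposition4p1:
  fixes \<Omega> D :: "(real^'n) set"
    and X :: "'m::finite \<Rightarrow> real^'n \<Rightarrow> real^'n"
    and g :: "real^'n \<Rightarrow> real^'n \<Rightarrow> real^'n \<Rightarrow> real"
    and u :: "real^'n \<Rightarrow> real^'k"
  assumes "CARD('m) \<le> CARD('n)"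
    and "open \<Omega>" and "connected \<Omega>"
    and "frame_on \<Omega> X"
    and "\<And>i. C1_on \<Omega> (X i)"
    and "riemannian_metric_on \<Omega> g"
    and "orthonormal_frame_on \<Omega> g X"
    and "carnot_caratheodory_space \<Omega> X"
    and "u \<in> Gamma2_rk \<Omega> X"
    and "infinity_laplace_system_on \<Omega> X u"
    and "open D" and "D \<noteq> {}"
    and "compact (closure D)" and "closure D \<subseteq> \<Omega>"
  shows "(bdd_above ((\<lambda>x. norm (hgrad X u x)) ` D) \<and>
          (\<exists>z\<in>frontier D.
             (\<forall>y\<in>frontier D. norm (hgrad X u y) \<le> norm (hgrad X u z)) \<and>
             (SUP x\<in>D. norm (hgrad X u x)) = norm (hgrad X u z))) \<and>
         (bdd_below ((\<lambda>x. norm (hgrad X u x)) ` D) \<and>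
          (\<exists>z\<in>frontier D.
             (\<forall>y\<in>frontier D. norm (hgrad X u z) \<le> norm (hgrad X u y)) \<and>
             (INF x\<in>D. norm (hgrad X u x)) = norm (hgrad X u z)))"
proof -
  have \<Omega>: "x \<in> \<Omega>" if "x \<in> closure D" for x
    using that \<open>closure D \<subseteq> \<Omega>\<close> by blast
  have D: "x \<in> closure D" if "x \<in> D" for x
    using that closure_subset by blast
  have F: "x \<in> closure D" if "x \<in> frontier D" for x
    using that by (simp add: frontier_def)
  have u: "continuous_on \<Omega> u" "\<And>i x. x \<in> \<Omega> \<Longrightarrow> has_lie_deriv_at (X i) u x"
      "\<And>i. C1_on \<Omega> (lie_deriv (X i) u)"
    and rk: "\<And>x. x \<in> \<Omega> \<Longrightarrow> rank (hgrad X u x) = min CARD('m) CARD('k)"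
    using \<open>u \<in> Gamma2_rk \<Omega> X\<close> by (auto simp: Gamma2_rk_def Gamma2_def)
  define f where "f x = (norm (hgrad X u x))\<^sup>2" for x
  have f_eq: "f = (\<lambda>x. \<Sum>j\<in>UNIV. lie_deriv (X j) u x \<bullet> lie_deriv (X j) u x)"
    by (rule ext) (simp add: f_def norm_hgrad_squared inner_vec_def)
  have C1: "C1_on \<Omega> f"
    unfolding f_eq by (rule C1_on_norm_squared_sum) (rule u(3))
  then obtain f' where f': "\<And>x. x \<in> \<Omega> \<Longrightarrow> (f has_derivative f' x) (at x)"
    unfolding C1_on_def by (elim exE conjE) (rule that, blast)
  have tang: "hgrad X u x *v (\<chi> i. f' x (X i x)) = 0" if "x \<in> \<Omega>" for x
    using infinity_laplace_tangential_part[OF \<open>infinity_laplace_system_on \<Omega> X u\<close> that u(3),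
        folded f_def, OF f'[OF that]] .
  have contf: "continuous_on (closure D) f"
    using f' \<Omega> by (meson continuous_at_imp_continuous_on has_derivative_continuous)
  have "\<exists>z\<in>frontier D. \<exists>z'\<in>frontier D. \<forall>x\<in>closure D. f x \<le> f z \<and> f z' \<le> f x"
  proof (cases "CARD('m) \<le> CARD('k)")
    case True
    have horiz: "f' x (X i x) = 0" if "x \<in> \<Omega>" for x i
    proof -
      have "inj ((*v) (hgrad X u x))"
        using rk[OF that] True by (simp add: full_rank_injective[symmetric])
      then have "(\<chi> i. f' x (X i x)) = 0"
        using tang[OF that] by (metis injD matrix_vector_mult_0_right)
      then show ?thesis
        by (metis vec_lambda_beta zero_index)
    qed
    have const: "f x = f y" if "x \<in> \<Omega>" "y \<in> \<Omega>" for x y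
    proof -
      obtain T r where "T > 0" "admissible_curve \<Omega> X T r" "r 0 = x" "r T = y"
        using \<open>carnot_caratheodory_space \<Omega> X\<close> \<open>x \<in> \<Omega>\<close> \<open>y \<in> \<Omega>\<close>
        unfolding carnot_caratheodory_space_def by blast
      then show ?thesis
        using horizontally_constant_along_admissible_curve[of \<Omega> f f' X T r] \<open>open \<Omega>\<close> C1 f' horiz by auto
    qed
    obtain z where "z \<in> frontier D"
      using \<open>compact (closure D)\<close> \<open>D \<noteq> {}\<close> by (metis closure_UNIV frontier_not_empty not_compact_UNIV ex_in_conv)
    then show ?thesis
      using const \<Omega> F by (metis order_refl)
  next
    case False
    \<comment> \<open>Any component of \<open>u\<close> serves as the transversal function.\<close>
    fix \<alpha> :: 'k
    define w where "w x = u x $ \<alpha>" for x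
    have nz: "\<exists>i. lie_deriv (X i) u x $ \<alpha> \<noteq> 0" if "x \<in> \<Omega>" for x
    proof (rule ccontr)
      assume "\<not> ?thesis"
      then have "(hgrad X u x *v h) $ \<alpha> = 0" for h
        by (simp add: matrix_vector_mult_def hgrad_def)
      moreover have "surj ((*v) (hgrad X u x))"
        using rk[OF that] False by (simp add: full_rank_surjective[symmetric])
      ultimately have "(axis \<alpha> 1 :: real^'k) $ \<alpha> = 0"
        by (metis surjD)
      then show False
        by (simp add: axis_def)
    qed
    have orth: "(\<Sum>i\<in>UNIV. lie_deriv (X i) u x $ \<alpha> * f' x (X i x)) = 0" if "x \<in> \<Omega>" for x
      using tang[OF that] by (simp add: vec_eq_iff matrix_vector_mult_def hgrad_def)
    have contw: "continuous_on (closure D) w"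
      unfolding w_def by (intro continuous_intros continuous_on_subset[OF u(1)] \<open>closure D \<subseteq> \<Omega>\<close>)
    have dw: "((\<lambda>t. w (x + t *\<^sub>R X i x)) has_real_derivative lie_deriv (X i) u x $ \<alpha>) (at 0)"
      if "x \<in> D" for x i
      using bounded_linear.has_vector_derivative[OF bounded_linear_vec_nth
          lie_deriv_has_vector_derivative[OF u(2)[OF \<Omega>[OF D[OF that]]]]]
      by (simp add: w_def has_real_derivative_iff_has_vector_derivative)
    have df: "((\<lambda>t. f (x + t *\<^sub>R X i x)) has_real_derivative f' x (X i x)) (at 0)" if "x \<in> D" for x i
      using has_derivative_along_line[OF f'[OF \<Omega>[OF D[OF that]]]]
      by (simp add: has_real_derivative_iff_has_vector_derivative)
    obtain z where "z \<in> frontier D" "\<And>x. x \<in> closure D \<Longrightarrow> f x \<le> f z"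
      by (rule frontier_max_of_transversal[where X = X and f' = "\<lambda>i x. f' x (X i x)",
            OF \<open>open D\<close> \<open>D \<noteq> {}\<close> \<open>compact (closure D)\<close> contf contw df dw])
        (use orth nz \<Omega> D in auto)
    moreover obtain z' where "z' \<in> frontier D" "\<And>x. x \<in> closure D \<Longrightarrow> - f x \<le> - f z'"
    proof (rule frontier_max_of_transversal[where X = X and f' = "\<lambda>i x. - f' x (X i x)",
          OF \<open>open D\<close> \<open>D \<noteq> {}\<close> \<open>compact (closure D)\<close> _ contw DERIV_minus[OF df] dw])
      show "continuous_on (closure D) (\<lambda>x. - f x)"
        by (intro continuous_intros contf)
    qed (use orth nz \<Omega> D in \<open>auto simp: sum_negf\<close>)
    ultimately show ?thesis
      by (metis neg_le_iff_le)
  qed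
  then obtain z z' where z: "z \<in> frontier D" "z' \<in> frontier D"
    and le: "\<And>x. x \<in> closure D \<Longrightarrow> norm (hgrad X u x) \<le> norm (hgrad X u z)"
      "\<And>x. x \<in> closure D \<Longrightarrow> norm (hgrad X u z') \<le> norm (hgrad X u x)"
    by (auto simp: f_def)
  have cont: "continuous_on (closure D) (\<lambda>x. norm (hgrad X u x))"
    using continuous_on_real_sqrt[OF contf] by (simp add: f_def)
  note sup = SUP_eq_frontier_max[OF \<open>D \<noteq> {}\<close> cont z(1) le(1)]
    and inf = INF_eq_frontier_min[OF \<open>D \<noteq> {}\<close> cont z(2) le(2)]
  show ?thesis
    by (rule conjI) (use sup inf z le F in \<open>simp_all, blast+\<close>)
qed

end
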